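(* For a semigroup $X$ the semigroup $\upsilon(X)$ is linear if and only if $X$ is either a semigroup of right zeros or a semigroup of left zeros.
   Context: A semigroup $S$ is linear if $xy\in\{x,y\}$ for all $x,y\in S$. A semigroup $S$ is a semigroup of left (resp. right) zeros if $xy=x$ (resp. $xy=y$) for all $x,y\in S$. For a set $X$, an upfamily on $X$ is a non-empty family $\mathcal F$ of non-empty subsets of $X$ such that $A\in\mathcal F$ and $A\subset B\subset X$ imply $B\in\mathcal F$; $\upsilon(X)$ is the set of all upfamilies on $X$. For a family $\mathcal B$ of subsets of $X$, $\langle\mathcal B\rangle=\{A\subset X:\exists B\in\mathcal B,\ B\subset A\}$. If $X$ is a semigroup, $\upsilon(X)$ is a semigroup under the operation $\mathcal U*\mathcal V=\big\langle\bigcup_{x\in U}xV_x: U\in\mathcal U,\ (V_x)_{x\in U}\in\mathcal V^U\big\rangle$. *)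

theory Defs
  imports Main "HOL-Library.FuncSet"
begin

text \<open>
  Semigroups are given by a carrier set and a binary operation on the ambient type, so that the
  same notions apply to \<open>X\<close> and to \<open>\<upsilon>(X)\<close>. The empty carrier is allowed.
\<close>

definition semigroup_on :: "'a set \<Rightarrow> ('a \<Rightarrow> 'a \<Rightarrow> 'a) \<Rightarrow> bool" where
  "semigroup_on S m \<longleftrightarrow>
     (\<forall>x\<in>S. \<forall>y\<in>S. m x y \<in> S) \<and>
     (\<forall>x\<in>S. \<forall>y\<in>S. \<forall>z\<in>S. m (m x y) z = m x (m y z))"

definition linear_semigroup :: "'a set \<Rightarrow> ('a \<Rightarrow> 'a \<Rightarrow> 'a) \<Rightarrow> bool" where
  "linear_semigroup S m \<longleftrightarrow> semigroup_on S m \<and> (\<forall>x\<in>S. \<forall>y\<in>S. m x y \<in> {x, y})"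

definition left_zeros_semigroup :: "'a set \<Rightarrow> ('a \<Rightarrow> 'a \<Rightarrow> 'a) \<Rightarrow> bool" where
  "left_zeros_semigroup S m \<longleftrightarrow> semigroup_on S m \<and> (\<forall>x\<in>S. \<forall>y\<in>S. m x y = x)"

definition right_zeros_semigroup :: "'a set \<Rightarrow> ('a \<Rightarrow> 'a \<Rightarrow> 'a) \<Rightarrow> bool" where
  "right_zeros_semigroup S m \<longleftrightarrow> semigroup_on S m \<and> (\<forall>x\<in>S. \<forall>y\<in>S. m x y = y)"

definition upfamily_on :: "'a set \<Rightarrow> 'a set set \<Rightarrow> bool" where
  "upfamily_on X F \<longleftrightarrow>
     F \<subseteq> Pow X \<and> F \<noteq> {} \<and> {} \<notin> F \<and> (\<forall>A B. A \<in> F \<and> A \<subseteq> B \<and> B \<subseteq> X \<longrightarrow> B \<in> F)"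

definition upfamilies :: "'a set \<Rightarrow> 'a set set set" where
  "upfamilies X = {F. upfamily_on X F}"

definition up_closure :: "'a set \<Rightarrow> 'a set set \<Rightarrow> 'a set set" where
  "up_closure X \<B> = {A. A \<subseteq> X \<and> (\<exists>B\<in>\<B>. B \<subseteq> A)}"

text \<open>
  A family \<open>(V\<^sub>x)\<close> indexed by \<open>x \<in> U\<close> is a function in \<open>U \<rightarrow> \<V>\<close>; its values
  outside \<open>U\<close> are irrelevant.
\<close>

definition upfamily_mult ::
    "'a set \<Rightarrow> ('a \<Rightarrow> 'a \<Rightarrow> 'a) \<Rightarrow> 'a set set \<Rightarrow> 'a set set \<Rightarrow> 'a set set" where
  "upfamily_mult X m \<U> \<V> =
     up_closure X {(\<Union>x\<in>U. m x ` V x) | U V. U \<in> \<U> \<and> V \<in> U \<rightarrow> \<V>}"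

lemma mem_upfamily_mult_iff:
  assumes X: "semigroup_on X m" and U: "upfamily_on X \<U>" and V: "upfamily_on X \<V>"
  shows "A \<in> upfamily_mult X m \<U> \<V> \<longleftrightarrow>
    A \<subseteq> X \<and> {x\<in>X. {y\<in>X. m x y \<in> A} \<in> \<V>} \<in> \<U>"
proof (intro iffI conjI)
  assume A: "A \<in> upfamily_mult X m \<U> \<V>"
  then show AX: "A \<subseteq> X" by (simp add: upfamily_mult_def up_closure_def)
  from A obtain W f where W: "W \<in> \<U>" "f \<in> W \<rightarrow> \<V>" and sub: "(\<Union>x\<in>W. m x ` f x) \<subseteq> A"
    unfolding upfamily_mult_def up_closure_def by blast
  have WX: "W \<subseteq> X" using W U by (auto simp: upfamily_on_def)
  have "{y\<in>X. m x y \<in> A} \<in> \<V>" if "x \<in> W" for x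
  proof -
    have fx: "f x \<in> \<V>" using W that by auto
    then have "f x \<subseteq> {y\<in>X. m x y \<in> A}"
      using V sub that by (auto simp: upfamily_on_def)
    then show ?thesis using fx V unfolding upfamily_on_def by blast
  qed
  then have "W \<subseteq> {x\<in>X. {y\<in>X. m x y \<in> A} \<in> \<V>}" using WX by auto
  then show "{x\<in>X. {y\<in>X. m x y \<in> A} \<in> \<V>} \<in> \<U>"
    using W(1) U unfolding upfamily_on_def by blast
next
  assume A: "A \<subseteq> X \<and> {x\<in>X. {y\<in>X. m x y \<in> A} \<in> \<V>} \<in> \<U>"
  let ?W = "{x\<in>X. {y\<in>X. m x y \<in> A} \<in> \<V>}"
  let ?f = "\<lambda>x. {y\<in>X. m x y \<in> A}"
  have "?f \<in> ?W \<rightarrow> \<V>" by auto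
  moreover have "(\<Union>x\<in>?W. m x ` ?f x) \<subseteq> A" by auto
  moreover have "?W \<in> \<U>" and "A \<subseteq> X" using A by simp_all
  ultimately show "A \<in> upfamily_mult X m \<U> \<V>"
    unfolding upfamily_mult_def up_closure_def
    by (intro CollectI conjI bexI[of _ "\<Union>x\<in>?W. m x ` ?f x"] exI[of _ ?W] exI[of _ ?f] refl)
qed

lemma upfamily_on_mult:
  assumes X: "semigroup_on X m" and U: "upfamily_on X \<U>" and V: "upfamily_on X \<V>"
  shows "upfamily_on X (upfamily_mult X m \<U> \<V>)"
proof -
  note iff = mem_upfamily_mult_iff[OF assms]
  have up: "B \<in> \<F>" if "upfamily_on X \<F>" "A \<in> \<F>" "A \<subseteq> B" "B \<subseteq> X" for A B \<F>
    using that unfolding upfamily_on_def by blast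
  have top: "X \<in> \<F>" if F: "upfamily_on X \<F>" for \<F>
  proof -
    obtain A where "A \<in> \<F>" "A \<subseteq> X" using F unfolding upfamily_on_def by blast
    then show ?thesis using up[OF F] by blast
  qed
  have XV: "X \<in> \<V>" and XU: "X \<in> \<U>" using top U V by simp_all
  have closed: "m x y \<in> X" if "x \<in> X" "y \<in> X" for x y
    using X that by (simp add: semigroup_on_def)
  have "{y\<in>X. m x y \<in> X} = X" if "x \<in> X" for x using closed that by auto
  then have "{x\<in>X. {y\<in>X. m x y \<in> X} \<in> \<V>} = X" using XV by (simp cong: conj_cong)
  then have "X \<in> upfamily_mult X m \<U> \<V>" using iff XU by simp
  moreover have "{} \<notin> upfamily_mult X m \<U> \<V>"
  proof -
    have "{} \<notin> \<V>" "{} \<notin> \<U>" using U V by (auto simp: upfamily_on_def)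
    then show ?thesis by (simp add: iff)
  qed
  moreover have "B \<in> upfamily_mult X m \<U> \<V>"
    if A: "A \<in> upfamily_mult X m \<U> \<V>" "A \<subseteq> B" "B \<subseteq> X" for A B
  proof -
    have "{x\<in>X. {y\<in>X. m x y \<in> A} \<in> \<V>} \<subseteq> {x\<in>X. {y\<in>X. m x y \<in> B} \<in> \<V>}"
    proof (intro subsetI CollectI conjI)
      fix x assume x: "x \<in> {x\<in>X. {y\<in>X. m x y \<in> A} \<in> \<V>}"
      then show "x \<in> X" by blast
      from x have "{y\<in>X. m x y \<in> A} \<in> \<V>" by blast
      then show "{y\<in>X. m x y \<in> B} \<in> \<V>"
        by (rule up[OF V]) (use A(2) in blast)+
    qed
    moreover have "{x\<in>X. {y\<in>X. m x y \<in> A} \<in> \<V>} \<in> \<U>"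
      using A(1) unfolding iff by blast
    ultimately have "{x\<in>X. {y\<in>X. m x y \<in> B} \<in> \<V>} \<in> \<U>"
      using up[OF U] by blast
    then show ?thesis using A(3) by (simp add: iff)
  qed
  moreover have "upfamily_mult X m \<U> \<V> \<subseteq> Pow X" by (auto simp: iff)
  ultimately show ?thesis
    unfolding upfamily_on_def by (intro conjI allI impI) (fastforce | blast)+
qed

lemma semigroup_on_upfamilies:
  assumes X: "semigroup_on X m"
  shows "semigroup_on (upfamilies X) (upfamily_mult X m)"
proof -
  have "upfamily_mult X m (upfamily_mult X m \<U> \<V>) \<W> =
        upfamily_mult X m \<U> (upfamily_mult X m \<V> \<W>)"
    if F: "upfamily_on X \<U>" "upfamily_on X \<V>" "upfamily_on X \<W>" for \<U> \<V> \<W>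
  proof (rule set_eqI)
    fix A
    have closed: "\<And>x y. x \<in> X \<Longrightarrow> y \<in> X \<Longrightarrow> m x y \<in> X"
      and assoc: "\<And>x y z. x \<in> X \<Longrightarrow> y \<in> X \<Longrightarrow> z \<in> X \<Longrightarrow> m (m x y) z = m x (m y z)"
      using X by (auto simp: semigroup_on_def)
    have eq1: "{y\<in>X. m x y \<in> {x\<in>X. {z\<in>X. m x z \<in> A} \<in> \<W>}} =
               {y\<in>X. {z\<in>X. m y z \<in> {y\<in>X. m x y \<in> A}} \<in> \<W>}" if x: "x \<in> X" for x
    proof -
      have "{z\<in>X. m (m x y) z \<in> A} = {z\<in>X. m y z \<in> {y\<in>X. m x y \<in> A}}" if "y \<in> X" for y
        using x that closed assoc by auto
      then show ?thesis using x closed by auto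
    qed
    have "A \<in> upfamily_mult X m (upfamily_mult X m \<U> \<V>) \<W> \<longleftrightarrow>
          A \<subseteq> X \<and> {x\<in>X. {y\<in>X. m x y \<in> {x\<in>X. {z\<in>X. m x z \<in> A} \<in> \<W>}} \<in> \<V>} \<in> \<U>"
      by (subst mem_upfamily_mult_iff[OF X upfamily_on_mult[OF X F(1,2)] F(3)],
          subst mem_upfamily_mult_iff[OF X F(1,2)]) blast
    also have "\<dots> \<longleftrightarrow>
          A \<subseteq> X \<and> {x\<in>X. {y\<in>X. {z\<in>X. m y z \<in> {y\<in>X. m x y \<in> A}} \<in> \<W>} \<in> \<V>} \<in> \<U>"
      using eq1 by (simp cong: conj_cong)
    also have "\<dots> \<longleftrightarrow> A \<in> upfamily_mult X m \<U> (upfamily_mult X m \<V> \<W>)"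
    proof -
      have "{y\<in>X. m x y \<in> A} \<in> upfamily_mult X m \<V> \<W> \<longleftrightarrow>
            {y\<in>X. {z\<in>X. m y z \<in> {y\<in>X. m x y \<in> A}} \<in> \<W>} \<in> \<V>" for x
        by (subst mem_upfamily_mult_iff[OF X F(2,3)]) blast
      then show ?thesis
        by (simp only: mem_upfamily_mult_iff[OF X F(1) upfamily_on_mult[OF X F(2,3)]])
    qed
    finally show "A \<in> upfamily_mult X m (upfamily_mult X m \<U> \<V>) \<W> \<longleftrightarrow>
                  A \<in> upfamily_mult X m \<U> (upfamily_mult X m \<V> \<W>)" .
  qed
  then show ?thesis
    using upfamily_on_mult[OF X] by (simp add: semigroup_on_def upfamilies_def)
qed

end

theory Submission
  imports Defs
begin

text \<open>
  The easy direction is a computation: if \<open>xy = x\<close> for all \<open>x, y\<close>, then \<open>A \<in> \<U> * \<V>\<close> unfolds to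
  \<open>A \<in> \<U>\<close>, and if \<open>xy = y\<close> it unfolds to \<open>A \<in> \<V>\<close>.

  For the converse, linearity of \<open>\<upsilon>(X)\<close> is tested on two kinds of products. Principal ultrafilters
  embed \<open>X\<close> into \<open>\<upsilon>(X)\<close>, so \<open>X\<close> is itself linear. If two distinct elements \<open>a, b\<close> commuted, say
  \<open>ab = ba = a\<close>, then \<open>\<langle>{{a, b}}\<rangle> * \<langle>{{a}, {b}}\<rangle>\<close> would be the principal ultrafilter at \<open>a\<close>, which is
  neither factor. So \<open>ab \<noteq> ba\<close> whenever \<open>a \<noteq> b\<close>. A linear semigroup with this property consists of
  left zeros or of right zeros (\<open>linear_noncommuting_imp_left_or_right_zeros\<close>), by
  associativity alone.
\<close>

lemma upfamily_mult_left_zeros: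
  assumes X: "left_zeros_semigroup X m" and U: "upfamily_on X \<U>" and V: "upfamily_on X \<V>"
  shows "upfamily_mult X m \<U> \<V> = \<U>"
proof (rule set_eqI)
  fix A
  have S: "semigroup_on X m" and lz: "\<And>x y. x \<in> X \<Longrightarrow> y \<in> X \<Longrightarrow> m x y = x"
    using X by (auto simp: left_zeros_semigroup_def)
  have V01: "X \<in> \<V>" "{} \<notin> \<V>" using V unfolding upfamily_on_def by blast+
  have "({y\<in>X. m x y \<in> A} \<in> \<V>) = (x \<in> A)" if "x \<in> X" for x
  proof -
    have "{y\<in>X. m x y \<in> A} = (if x \<in> A then X else {})" using lz that by auto
    then show ?thesis using V01 by simp
  qed
  then have "{x\<in>X. {y\<in>X. m x y \<in> A} \<in> \<V>} = X \<inter> A" by auto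
  moreover have "A \<in> \<U> \<Longrightarrow> A \<subseteq> X" using U unfolding upfamily_on_def by blast
  ultimately show "A \<in> upfamily_mult X m \<U> \<V> \<longleftrightarrow> A \<in> \<U>"
    by (auto simp: mem_upfamily_mult_iff[OF S U V] inf_absorb2)
qed

lemma upfamily_mult_right_zeros:
  assumes X: "right_zeros_semigroup X m" and U: "upfamily_on X \<U>" and V: "upfamily_on X \<V>"
  shows "upfamily_mult X m \<U> \<V> = \<V>"
proof (rule set_eqI)
  fix A
  have S: "semigroup_on X m" and rz: "\<And>x y. x \<in> X \<Longrightarrow> y \<in> X \<Longrightarrow> m x y = y"
    using X by (auto simp: right_zeros_semigroup_def)
  have U01: "X \<in> \<U>" "{} \<notin> \<U>" using U unfolding upfamily_on_def by blast+
  have "{y\<in>X. m x y \<in> A} = X \<inter> A" if "x \<in> X" for x using rz that by auto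
  then have "{x\<in>X. {y\<in>X. m x y \<in> A} \<in> \<V>} = (if X \<inter> A \<in> \<V> then X else {})" by auto
  moreover have "A \<in> \<V> \<Longrightarrow> A \<subseteq> X" using V unfolding upfamily_on_def by blast
  ultimately show "A \<in> upfamily_mult X m \<U> \<V> \<longleftrightarrow> A \<in> \<V>"
    using U01 by (auto simp: mem_upfamily_mult_iff[OF S U V] inf_absorb2)
qed

text \<open>
  The product of the principal ultrafilters at \<open>a\<close> and \<open>b\<close> is the principal ultrafilter at \<open>ab\<close>,
  and a principal ultrafilter determines its point.
\<close>

lemma linear_upfamilies_imp_linear:
  assumes S: "semigroup_on X m"
    and lin: "linear_semigroup (upfamilies X) (upfamily_mult X m)"
  shows "linear_semigroup X m"
  unfolding linear_semigroup_def
proof (intro conjI S ballI)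
  fix a b assume ab: "a \<in> X" "b \<in> X"
  define P where "P c = {A. A \<subseteq> X \<and> c \<in> A}" for c
  have up: "upfamily_on X (P c)" if "c \<in> X" for c
    using that by (auto simp: upfamily_on_def P_def)
  have inj: "c = d" if "P c = P d" "d \<in> X" for c d
  proof -
    have "{d} \<in> P d" using that by (simp add: P_def)
    then have "{d} \<in> P c" using that(1) by simp
    then show ?thesis by (simp add: P_def)
  qed
  have "upfamily_mult X m (P a) (P b) = P (m a b)"
  proof (rule set_eqI)
    fix A
    show "A \<in> upfamily_mult X m (P a) (P b) \<longleftrightarrow> A \<in> P (m a b)"
      unfolding mem_upfamily_mult_iff[OF S up[OF ab(1)] up[OF ab(2)]]
      using ab by (auto simp: P_def)
  qed
  moreover have "upfamily_mult X m (P a) (P b) \<in> {P a, P b}"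
    using lin up[OF ab(1)] up[OF ab(2)] unfolding linear_semigroup_def upfamilies_def by blast
  ultimately have "P (m a b) \<in> {P a, P b}" by simp
  then show "m a b \<in> {a, b}" using inj ab by blast
qed

text \<open>
  The family \<open>\<U> = \<langle>{{a, b}}\<rangle>\<close> requires both points and \<open>\<V> = \<langle>{{a}, {b}}\<rangle>\<close> leaves the choice between
  them. In \<open>\<U> * \<V>\<close> the factor \<open>a\<close> can only produce \<open>a\<close>, so every member contains \<open>a\<close>; and the
  choice \<open>V\<^sub>a = V\<^sub>b = {a}\<close> realises \<open>{a}\<close>. Thus the product contains \<open>{a}\<close>, unlike \<open>\<U>\<close>, but not \<open>{b}\<close>,
  unlike \<open>\<V>\<close>.
\<close>

lemma linear_upfamilies_imp_no_zero_pair: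
  assumes S: "semigroup_on X m"
    and lin: "linear_semigroup (upfamilies X) (upfamily_mult X m)"
    and ab: "a \<in> X" "b \<in> X" "a \<noteq> b"
    and prod: "m a b = a" "m b a = a"
  shows False
proof -
  define U where "U = {A. A \<subseteq> X \<and> a \<in> A \<and> b \<in> A}"
  define V where "V = {A. A \<subseteq> X \<and> (a \<in> A \<or> b \<in> A)}"
  have up: "upfamily_on X U" "upfamily_on X V"
    using ab by (auto simp: upfamily_on_def U_def V_def)
  have aa: "m a a = a"
    using linear_upfamilies_imp_linear[OF S lin] ab by (auto simp: linear_semigroup_def)
  have "{a} \<in> upfamily_mult X m U V" "{b} \<notin> upfamily_mult X m U V"
    unfolding mem_upfamily_mult_iff[OF S up] using ab prod aa by (auto simp: U_def V_def)
  moreover have "{a} \<notin> U" "{b} \<in> V" using ab by (auto simp: U_def V_def)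
  moreover have "upfamily_mult X m U V \<in> {U, V}"
    using lin up by (auto simp: linear_semigroup_def upfamilies_def)
  ultimately show False by auto
qed

text \<open>
  For distinct \<open>a, b\<close>, either \<open>ab = a\<close> and \<open>ba = b\<close>, or \<open>ab = b\<close> and \<open>ba = a\<close>. Associativity forbids
  an element \<open>a\<close> from behaving one way with \<open>b\<close> and the other way with \<open>c\<close>, so each element is a
  left zero or a left identity. One left zero \<open>a\<close> forces \<open>xa = x\<close> for every other \<open>x\<close>, so that \<open>x\<close> is
  no left identity and hence is a left zero too.
\<close>

lemma linear_noncommuting_imp_left_or_right_zeros:
  assumes lin: "linear_semigroup X m"
    and nc: "\<And>a b. a \<in> X \<Longrightarrow> b \<in> X \<Longrightarrow> a \<noteq> b \<Longrightarrow> m a b \<noteq> m b a"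
  shows "right_zeros_semigroup X m \<or> left_zeros_semigroup X m"
proof -
  have S: "semigroup_on X m" using lin by (simp add: linear_semigroup_def)
  have cl: "\<And>x y. x \<in> X \<Longrightarrow> y \<in> X \<Longrightarrow> m x y = x \<or> m x y = y"
    using lin by (auto simp: linear_semigroup_def)
  have as: "\<And>x y z. x \<in> X \<Longrightarrow> y \<in> X \<Longrightarrow> z \<in> X \<Longrightarrow> m (m x y) z = m x (m y z)"
    using S by (auto simp: semigroup_on_def)
  have dich: "(\<forall>x\<in>X. m a x = a) \<or> (\<forall>x\<in>X. m a x = x)" if a: "a \<in> X" for a
  proof (rule ccontr)
    assume "\<not> ?thesis"
    then obtain b c where b: "b \<in> X" "m a b = a" "a \<noteq> b" and c: "c \<in> X" "m a c = c" "a \<noteq> c"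
      using cl[OF a] by metis
    have "b \<noteq> c" using b c by auto
    show False
    proof (cases "m b c = b")
      case True
      then have "c = a" using as[OF a b(1) c(1)] b c by simp
      then show False using c by simp
    next
      case False
      then have "m c b = b" using cl[of b c] cl[of c b] nc[of b c] b c \<open>b \<noteq> c\<close> by auto
      then have "a = b" using as[OF a c(1) b(1)] b c by simp
      then show False using b by simp
    qed
  qed
  show ?thesis
  proof (cases "\<exists>a\<in>X. \<forall>x\<in>X. m a x = a")
    case True
    then obtain a where a: "a \<in> X" "\<forall>x\<in>X. m a x = a" by blast
    have "\<forall>y\<in>X. m x y = x" if x: "x \<in> X" for x
    proof (cases "x = a")
      case False
      then have "m x a \<noteq> a" using nc[OF x a(1)] a x by auto
      then show ?thesis using dich[OF x] a(1) by auto
    qed (use a in auto)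
    then show ?thesis using S by (simp add: left_zeros_semigroup_def)
  next
    case False
    then show ?thesis using dich S by (auto simp: right_zeros_semigroup_def)
  qed
qed

theorem theorem4p1:
  fixes X :: "'a set" and m :: "'a \<Rightarrow> 'a \<Rightarrow> 'a"
  assumes "semigroup_on X m"
  shows "linear_semigroup (upfamilies X) (upfamily_mult X m) \<longleftrightarrow>
    right_zeros_semigroup X m \<or> left_zeros_semigroup X m"
proof
  assume lin: "linear_semigroup (upfamilies X) (upfamily_mult X m)"
  have X: "linear_semigroup X m" using linear_upfamilies_imp_linear[OF assms lin] .
  have "m a b \<noteq> m b a" if ab: "a \<in> X" "b \<in> X" "a \<noteq> b" for a b
  proof
    assume eq: "m a b = m b a"
    have "m a b = a \<or> m a b = b" using X ab by (auto simp: linear_semigroup_def)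
    then show False
      using linear_upfamilies_imp_no_zero_pair[OF assms lin, of a b]
        linear_upfamilies_imp_no_zero_pair[OF assms lin, of b a] ab eq by auto
  qed
  then show "right_zeros_semigroup X m \<or> left_zeros_semigroup X m"
    by (rule linear_noncommuting_imp_left_or_right_zeros[OF X])
next
  assume "right_zeros_semigroup X m \<or> left_zeros_semigroup X m"
  then show "linear_semigroup (upfamilies X) (upfamily_mult X m)"
    using semigroup_on_upfamilies[OF assms] upfamily_mult_left_zeros[of X m]
      upfamily_mult_right_zeros[of X m]
    by (auto simp: linear_semigroup_def upfamilies_def)
qed

end
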